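(* Let $n,k \in \mathbb{N}$ and $p,\lambda \in \mathbb{R}$ be such that $1<k<n/2$, $p\ge 1$, and $-1/2 \le \lambda \le 0$. Put $d = \binom{n}{2}$ and $$t_0 = \frac{(3k-n)|\lambda|^p+k|1+\lambda|^p+(1/2-k)|1+2\lambda|^p}{2|\lambda|^p+2|1+\lambda|^p-|1+2\lambda|^p}.$$ Let $t_1\le \lfloor t_0+1/2 \rfloor$ be the largest integer such that $k-t_1$ is a prime or a prime power. If $0<t_1<k/2$, then $$b(\ell_p^d) \ge \binom{n}{k} \Big/ \binom{n}{k-t_1-1}.$$
   Context: For a $d$-dimensional real normed space $\mathbb{M}^d$, its Borsuk number $b(\mathbb{M}^d)$ is the minimum $m \in \mathbb{N}$ such that every bounded non-singleton subset of $\mathbb{M}^d$ can be partitioned into $m$ parts of smaller diameter (each part has diameter strictly smaller than that of the whole set, where diameters are measured in the norm of $\mathbb{M}^d$). For real $p\ge 1$, $\ell_p^d$ denotes $\mathbb{R}^d$ equipped with the norm $\|\mathbf{x}\|_p = \left(\sum_{i=1}^d |x_i|^p\right)^{1/p}$. The right-hand side of the final inequality is a quotient of two binomial coefficients, taken as a real number. A prime power is a number $r^m$ with $r$ prime and $m\ge 1$ an integer. *)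

theory Defs
  imports
    "Jordan_Normal_Form.Matrix"
    "HOL-Library.Disjoint_Sets"
    "HOL-Number_Theory.Prime_Powers"
begin

text \<open>
  A normed space is given by a carrier \<open>V\<close> and a norm \<open>N\<close> on it, because the dimension
  of the space has to be an ordinary natural number and the norm varies with \<open>p\<close>.
  The space \<open>\<ell>\<^sub>p\<^sup>d\<close> is \<open>carrier_vec d\<close> (real vectors) with the norm \<open>lp_norm p\<close>.
\<close>

definition lp_norm :: "real \<Rightarrow> real vec \<Rightarrow> real" where
  "lp_norm p x = (\<Sum>i<dim_vec x. \<bar>x $ i\<bar> powr p) powr (1 / p)"

definition norm_bounded :: "('a \<Rightarrow> real) \<Rightarrow> 'a set \<Rightarrow> bool" where
  "norm_bounded N S \<longleftrightarrow> (\<exists>B. \<forall>x\<in>S. N x \<le> B)"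

text \<open>Meaningful for nonempty sets that are bounded with respect to \<open>N\<close>.\<close>

definition norm_diameter :: "('a::minus \<Rightarrow> real) \<Rightarrow> 'a set \<Rightarrow> real" where
  "norm_diameter N S = (SUP (x, y)\<in>S \<times> S. N (x - y))"

text \<open>
  The classes of a \<^const>\<open>partition_on\<close> are nonempty, so ``\<open>m\<close> parts'' is read as ``at most
  \<open>m\<close> nonempty parts'', which amounts to allowing empty parts: a set of two points has no
  partition into three nonempty parts.  The empty set is harmless, as it has the
  partition without classes.
\<close>

definition borsuk_partitionable :: "('a::minus \<Rightarrow> real) \<Rightarrow> nat \<Rightarrow> 'a set \<Rightarrow> bool" where
  "borsuk_partitionable N m S \<longleftrightarrow>
     (\<exists>P. partition_on S P \<and> finite P \<and> card P \<le> m \<and>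
          (\<forall>A\<in>P. norm_diameter N A < norm_diameter N S))"

text \<open>The minimum exists when \<open>V\<close> is a finite-dimensional space normed by \<open>N\<close>.\<close>

definition borsuk_number :: "'a::minus set \<Rightarrow> ('a \<Rightarrow> real) \<Rightarrow> nat" where
  "borsuk_number V N =
     (LEAST m. \<forall>S\<subseteq>V. norm_bounded N S \<and> \<not> is_singleton S \<longrightarrow> borsuk_partitionable N m S)"

end

theory Submission
  imports Defs "Jordan_Normal_Form.Determinant" "HOL-Computational_Algebra.Formal_Power_Series"
begin

text \<open>
  Send a \<open>k\<close>-subset \<open>A\<close> of \<open>{0..<n}\<close> with indicator \<open>a\<close> to the vector with entries
  \<open>lam * (a i + a j) + a i * a j\<close>, \<open>i < j < n\<close>.  The \<open>p\<close>-th power of the distance between the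
  images of \<open>A\<close> and \<open>B\<close> is a concave quadratic function of \<open>card (A \<inter> B)\<close> with vertex \<open>t0\<close>.  The vertex
  depends continuously on \<open>lam\<close> and equals \<open>1/2\<close> at \<open>lam = 0\<close>, so after moving \<open>lam\<close> towards \<open>0\<close>
  the integer nearest to it is \<open>t1\<close>, and the diameter is attained whenever \<open>card (A \<inter> B) = t1\<close>.
  A part of smaller diameter thus comes from a family avoiding the intersection size \<open>t1\<close>.
  With \<open>q = k - t1\<close> a prime power and \<open>k < 2 * q\<close>, avoiding \<open>t1\<close> means avoiding the residue of \<open>k\<close>
  modulo \<open>q\<close>, and the Frankl--Wilson theorem bounds such a family by \<open>n choose (q - 1)\<close>.

  For the latter, \<open>(k - x + q - 1) choose (q - 1)\<close> is divisible by the prime \<open>r\<close> of which \<open>q\<close> is a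
  power unless \<open>q\<close> divides \<open>k - x\<close>.  The matrix of these numbers for \<open>x = card (A \<inter> B)\<close> therefore has
  determinant \<open>1\<close> modulo \<open>r\<close>, while its entries are of degree \<open>q - 1\<close> in \<open>x\<close>, so that over the
  rationals it factors through the space indexed by \<open>(q - 1)\<close>-subsets.
\<close>

section \<open>The Frankl--Wilson bound\<close>

lemma card_le_card_if_factors_mod_prime:
  fixes M :: "'a \<Rightarrow> 'a \<Rightarrow> int" and W :: "'a \<Rightarrow> 'b \<Rightarrow> rat" and U :: "'b \<Rightarrow> 'a \<Rightarrow> rat"
  assumes fin: "finite F" "finite G" and "prime r"
    and diag: "\<And>A. A \<in> F \<Longrightarrow> \<not> r dvd M A A"
    and off: "\<And>A B. A \<in> F \<Longrightarrow> B \<in> F \<Longrightarrow> A \<noteq> B \<Longrightarrow> r dvd M A B"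
    and fact: "\<And>A B. A \<in> F \<Longrightarrow> B \<in> F \<Longrightarrow> of_int (M A B) = (\<Sum>J\<in>G. W A J * U J B)"
  shows "card F \<le> card G"
proof (rule ccontr)
  \<comment> \<open>Padding both factors by zeros to square matrices gives determinant \<open>0\<close>, but modulo \<open>r\<close>
    only the identity contributes to the Leibniz formula.\<close>
  define m where "m = card F"
  define N where "N = card G"
  assume "\<not> card F \<le> card G"
  hence "N < m" by (simp add: m_def N_def)
  obtain f where f: "bij_betw f {0..<m} F"
    using ex_bij_betw_nat_finite[OF fin(1)] m_def by blast
  obtain g where g: "bij_betw g {0..<N} G"
    using ex_bij_betw_nat_finite[OF fin(2)] N_def by blast
  have fF: "f i \<in> F" if "i < m" for i using f that by (auto simp: bij_betw_def)
  have finj: "f i \<noteq> f j" if "i < m" "j < m" "i \<noteq> j" for i j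
    using f that by (auto simp: bij_betw_def inj_on_def)
  define Mi where "Mi = mat m m (\<lambda>(i, j). M (f i) (f j))"
  define W' where "W' = mat m m (\<lambda>(i, j). if j < N then W (f i) (g j) else 0)"
  define U' where "U' = mat m m (\<lambda>(i, j). if i < N then U (g i) (f j) else 0)"
  have carr: "Mi \<in> carrier_mat m m" "W' \<in> carrier_mat m m" "U' \<in> carrier_mat m m"
    by (auto simp: Mi_def W'_def U'_def)
  \<comment> \<open>Since \<open>N < m\<close>, column \<open>m - 1\<close> of \<open>W'\<close> is
    padding, and the last unit vector lies in the kernel.\<close>
  have "det W' = 0"
  proof -
    have "unit_vec m (m - 1) \<noteq> (0\<^sub>v m :: rat vec)"
      using \<open>N < m\<close> by (auto simp: unit_vec_def zero_vec_def vec_eq_iff)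
    moreover have "W' *\<^sub>v unit_vec m (m - 1) = 0\<^sub>v m"
      using \<open>N < m\<close> by (intro eq_vecI) (auto simp: W'_def)
    ultimately show ?thesis
      using det_0_iff_vec_prod_zero[OF carr(2)] by (metis unit_vec_carrier)
  qed
  moreover have "map_mat rat_of_int Mi = W' * U'"
  proof (rule eq_matI)
    fix i j assume "i < dim_row (W' * U')" "j < dim_col (W' * U')"
    hence ij: "i < m" "j < m" using carr by auto
    have "(W' * U') $$ (i, j) = (\<Sum>l\<in>{0..<m}. if l < N then W (f i) (g l) * U (g l) (f j) else 0)"
      using ij by (auto simp: W'_def U'_def scalar_prod_def intro!: sum.cong)
    also have "\<dots> = (\<Sum>l\<in>{0..<N}. W (f i) (g l) * U (g l) (f j))"
      using \<open>N < m\<close> by (intro sum.mono_neutral_cong_right) auto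
    also have "\<dots> = (\<Sum>J\<in>G. W (f i) J * U J (f j))"
      using sum.reindex_bij_betw[OF g, of "\<lambda>J. W (f i) J * U J (f j)"] by simp
    finally show "map_mat rat_of_int Mi $$ (i, j) = (W' * U') $$ (i, j)"
      using ij fact[OF fF fF, of i j] by (simp add: Mi_def)
  qed (use carr in auto)
  ultimately have "rat_of_int (det Mi) = 0"
    using det_mult[OF carr(2,3)] by (simp add: of_int_hom.hom_det[symmetric])
  hence det0: "det Mi = 0" by simp
  let ?P = "{\<pi>. \<pi> permutes {0..<m}}"
  let ?t = "\<lambda>\<pi>. signof \<pi> * (\<Prod>i = 0..<m. Mi $$ (i, \<pi> i))"
  have finP: "finite ?P" by (simp add: finite_permutations)
  have "det Mi = (\<Sum>\<pi>\<in>?P. ?t \<pi>)" using carr by (simp add: det_def)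
  also have "\<dots> = ?t id + (\<Sum>\<pi>\<in>?P - {id}. ?t \<pi>)"
    using finP by (subst sum.remove[of _ id]) (auto simp: permutes_id)
  finally have "?t id = - (\<Sum>\<pi>\<in>?P - {id}. ?t \<pi>)"
    unfolding det0 by (rule eq_neg_iff_add_eq_0[THEN iffD2, OF sym])
  moreover have "r dvd (\<Sum>\<pi>\<in>?P - {id}. ?t \<pi>)"
  proof (rule dvd_sum)
    fix \<pi> assume "\<pi> \<in> ?P - {id}"
    hence \<pi>: "\<pi> permutes {0..<m}" "\<pi> \<noteq> id" by auto
    then obtain i where i: "\<pi> i \<noteq> i" by (auto simp: fun_eq_iff)
    hence im: "i \<in> {0..<m}" using \<pi> by (meson permutes_not_in)
    have "r dvd Mi $$ (i, \<pi> i)"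
      using off[OF fF fF finj, of i "\<pi> i"] im i permutes_in_image[OF \<pi>(1), of i]
      by (auto simp: Mi_def)
    also have "\<dots> dvd (\<Prod>i = 0..<m. Mi $$ (i, \<pi> i))"
      using im by (intro dvd_prodI[of "{0..<m}" i "\<lambda>i. Mi $$ (i, \<pi> i)"]) auto
    finally have "r dvd (\<Prod>i = 0..<m. Mi $$ (i, \<pi> i))" .
    thus "r dvd ?t \<pi>" by simp
  qed
  ultimately have "r dvd ?t id"
    by (simp only: dvd_minus_iff)
  hence "r dvd (\<Prod>i = 0..<m. M (f i) (f i))"
    by (simp add: Mi_def)
  then obtain i where "i < m" "r dvd M (f i) (f i)"
    using \<open>prime r\<close> by (auto simp: prime_dvd_prod_iff)
  thus False using diag[OF fF] by blast
qed

section \<open>Divisibility and expansion of binomial coefficients\<close>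

text \<open>Absorption with \<open>q = r ^ e\<close>: the coefficient times \<open>y + q\<close>
  equals \<open>q * ((y + q) choose q)\<close>. If \<open>r\<close> did not divide the coefficient,
  \<open>q\<close> would be coprime to it and would have to divide \<open>y + q\<close>, hence
  \<open>y\<close>.\<close>

lemma prime_dvd_binomial_primepow:
  assumes "prime r" and "\<not> r ^ e dvd y"
  shows "r dvd (y + (r ^ e - 1)) choose (r ^ e - 1)"
proof (rule ccontr)
  let ?q = "r ^ e" and ?c = "(y + (r ^ e - 1)) choose (r ^ e - 1)"
  assume "\<not> r dvd ?c"
  hence cop: "coprime ?q ?c"
    using \<open>prime r\<close> by (meson coprime_power_left_iff prime_imp_coprime)
  have q: "?q > 0" using \<open>prime r\<close> by (simp add: prime_gt_0_nat)
  obtain s where s: "?q = Suc s" using q gr0_conv_Suc by blast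
  have "(y + ?q) * ?c = ((y + ?q) choose ?q) * ?q"
    using Suc_times_binomial_eq[of "y + s" s] unfolding s by (simp del: binomial_Suc_Suc)
  hence "?q dvd (y + ?q) * ?c" by simp
  hence "?q dvd y + ?q" using cop by (simp add: coprime_dvd_mult_left_iff)
  thus False using assms(2) by simp
qed

lemma card_supersets_between:
  assumes "finite A" "I \<subseteq> A"
  shows "card {J. I \<subseteq> J \<and> J \<subseteq> A \<and> card J = s} =
    (if card I \<le> s then (card A - card I) choose (s - card I) else 0)"
proof (cases "card I \<le> s")
  case True
  have fI: "finite I" using assms finite_subset by blast
  have "bij_betw (\<lambda>J. J - I) {J. I \<subseteq> J \<and> J \<subseteq> A \<and> card J = s}
          {K. K \<subseteq> A - I \<and> card K = s - card I}"
  proof (rule bij_betwI[where g = "\<lambda>K. K \<union> I"])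
    show "(\<lambda>J. J - I) \<in> {J. I \<subseteq> J \<and> J \<subseteq> A \<and> card J = s} \<rightarrow>
          {K. K \<subseteq> A - I \<and> card K = s - card I}"
      using fI by (auto simp: card_Diff_subset)
    show "(\<lambda>K. K \<union> I) \<in> {K. K \<subseteq> A - I \<and> card K = s - card I} \<rightarrow>
          {J. I \<subseteq> J \<and> J \<subseteq> A \<and> card J = s}"
    proof safe
      fix K assume K: "K \<subseteq> A - I" "card K = s - card I"
      have "finite K" "K \<inter> I = {}" using K assms finite_subset by blast+
      thus "card (K \<union> I) = s" using K True fI by (simp add: card_Un_disjoint)
    qed (use assms in auto)
  qed auto
  hence "card {J. I \<subseteq> J \<and> J \<subseteq> A \<and> card J = s} = card {K. K \<subseteq> A - I \<and> card K = s - card I}"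
    by (rule bij_betw_same_card)
  also have "\<dots> = (card A - card I) choose (s - card I)"
    using assms fI by (subst n_subsets) (auto simp: card_Diff_subset)
  finally show ?thesis using True by simp
next
  case False
  have "card I \<le> card J" if "I \<subseteq> J" "J \<subseteq> A" for J
    using that assms by (meson card_mono finite_subset)
  hence empty: "{J. I \<subseteq> J \<and> J \<subseteq> A \<and> card J = s} = {}" using False by auto
  show ?thesis unfolding empty using False by simp
qed

text \<open>Double counting of the pairs \<open>I \<subseteq> J\<close> with \<open>I\<close> an
  \<open>i\<close>-subset of \<open>A \<inter> B\<close> and \<open>J\<close> an
  \<open>s\<close>-subset of \<open>A\<close>. Read backwards, it expresses
  \<open>card (A \<inter> B) choose i\<close>, up to a constant, through \<open>s\<close>-subsets of
  \<open>A\<close> for every \<open>i \<le> s\<close> at once, so that a single index set serves all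
  degrees.\<close>

lemma sum_binomial_inter_subsets:
  assumes "finite A" "i \<le> s"
  shows "(\<Sum>J | J \<subseteq> A \<and> card J = s. card (J \<inter> B) choose i) =
    (card (A \<inter> B) choose i) * ((card A - i) choose (s - i))"
proof -
  let ?Js = "{J. J \<subseteq> A \<and> card J = s}" and ?Is = "{I. I \<subseteq> A \<inter> B \<and> card I = i}"
  have fin: "finite ?Js" "finite ?Is"
    using assms by (auto intro: finite_subset[of _ "Pow A"])
  have "(\<Sum>J\<in>?Js. card (J \<inter> B) choose i) = (\<Sum>J\<in>?Js. \<Sum>I\<in>?Is. of_bool (I \<subseteq> J))"
  proof (rule sum.cong[OF refl])
    fix J assume "J \<in> ?Js"
    hence J: "J \<subseteq> A" "finite J" using assms finite_subset by auto
    have "card (J \<inter> B) choose i = card {I. I \<subseteq> J \<inter> B \<and> card I = i}"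
      using J by (subst n_subsets) auto
    also have "{I. I \<subseteq> J \<inter> B \<and> card I = i} = {I\<in>?Is. I \<subseteq> J}" using J by auto
    also have "card \<dots> = (\<Sum>I\<in>?Is. of_bool (I \<subseteq> J))"
      using fin by (simp add: of_bool_def sum.If_cases Int_def)
    finally show "card (J \<inter> B) choose i = (\<Sum>I\<in>?Is. of_bool (I \<subseteq> J))" .
  qed
  also have "\<dots> = (\<Sum>I\<in>?Is. \<Sum>J\<in>?Js. of_bool (I \<subseteq> J))" by (rule sum.swap)
  also have "\<dots> = (\<Sum>I\<in>?Is. (card A - i) choose (s - i))"
  proof (rule sum.cong[OF refl])
    fix I assume I: "I \<in> ?Is"
    have "(\<Sum>J\<in>?Js. of_bool (I \<subseteq> J)) = card {J. I \<subseteq> J \<and> J \<subseteq> A \<and> card J = s}"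
      using fin by (simp add: of_bool_def sum.If_cases Int_def conj_ac)
    thus "(\<Sum>J\<in>?Js. of_bool (I \<subseteq> J)) = (card A - i) choose (s - i)"
      using I assms card_supersets_between[of A I s] by auto
  qed
  also have "\<dots> = card ?Is * ((card A - i) choose (s - i))" by simp
  also have "card ?Is = card (A \<inter> B) choose i"
    using assms by (subst n_subsets[symmetric]) auto
  finally show ?thesis .
qed

text \<open>Vandermonde convolution for \<open>x + (- k - 1) = - (k - x + 1)\<close>, followed by
  negation of the upper index. The coefficients of the basis polynomials \<open>x choose i\<close>
  do not depend on \<open>x\<close>.\<close>

lemma binomial_eq_sum_gchoose:
  assumes "x \<le> k"
  shows "of_nat ((k - x + s) choose s) =
    (\<Sum>i\<le>s. of_nat (x choose i) * ((-1) ^ s * ((- of_nat k - 1) gchoose (s - i))) :: rat)"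
proof -
  have "(\<Sum>i\<le>s. (of_nat x gchoose i) * ((- of_nat k - 1) gchoose (s - i))) =
      (of_nat x + (- of_nat k - 1) :: rat) gchoose s"
    using gbinomial_Vandermonde[of "of_nat x :: rat" "- of_nat k - 1" s] by (simp add: atLeast0AtMost)
  also have "of_nat x + (- of_nat k - 1) = (- of_nat (k - x + 1) :: rat)"
    using assms by (simp add: of_nat_diff)
  also have "\<dots> gchoose s = (-1) ^ s * (of_nat (k - x + s) gchoose s)"
    by (subst gbinomial_minus) (simp add: add_ac)
  finally have "(-1) ^ s * (\<Sum>i\<le>s. (of_nat x gchoose i) * ((- of_nat k - 1) gchoose (s - i))) =
      (of_nat (k - x + s) gchoose s :: rat)"
    by (simp flip: power_mult_distrib mult.assoc)
  thus ?thesis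
    by (simp add: binomial_gbinomial sum_distrib_left mult_ac)
qed

theorem frankl_wilson:
  assumes "finite V" and F: "\<And>A. A \<in> F \<Longrightarrow> A \<subseteq> V \<and> card A = k"
    and "prime r" and "r ^ e \<le> Suc k"
    and inter: "\<And>A B. A \<in> F \<Longrightarrow> B \<in> F \<Longrightarrow> A \<noteq> B \<Longrightarrow> \<not> r ^ e dvd k - card (A \<inter> B)"
  shows "card F \<le> card V choose (r ^ e - 1)"
proof -
  define s where "s = r ^ e - 1"
  have "s \<le> k" using assms(4) by (simp add: s_def)
  let ?G = "{J. J \<subseteq> V \<and> card J = s}"
  define coef :: "nat \<Rightarrow> rat" where
    "coef i = (-1) ^ s * ((- of_nat k - 1) gchoose (s - i))" for i
  \<comment> \<open>The denominator cancels the number of \<open>s\<close>-subsets of a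
    \<open>k\<close>-set that contain a given \<open>i\<close>-subset.\<close>
  define U :: "'a set \<Rightarrow> 'a set \<Rightarrow> rat" where
    "U J B = (\<Sum>i\<le>s. coef i / of_nat ((k - i) choose (s - i)) * of_nat (card (J \<inter> B) choose i))" for J B
  define M :: "'a set \<Rightarrow> 'a set \<Rightarrow> int" where
    "M A B = int ((k - card (A \<inter> B) + s) choose s)" for A B
  have finA: "finite A" if "A \<in> F" for A using F[OF that] assms(1) finite_subset by blast
  have "finite F" using F assms(1) by (intro finite_subset[of F "Pow V"]) auto
  have "finite ?G" using assms(1) by auto
  have "card F \<le> card ?G"
  proof (rule card_le_card_if_factors_mod_prime[OF \<open>finite F\<close> \<open>finite ?G\<close>, where r = "int r"
        and M = M and W = "\<lambda>A J. of_bool (J \<subseteq> A)" and U = U])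
    show "prime (int r)" using \<open>prime r\<close> by simp
    \<comment> \<open>Since \<open>card (A \<inter> A) = k\<close>, the diagonal entry is
      \<open>s choose s = 1\<close>.\<close>
    show "\<not> int r dvd M A A" if "A \<in> F" for A
      using F[OF that] \<open>prime r\<close> by (auto simp: M_def)
    show "int r dvd M A B" if "A \<in> F" "B \<in> F" "A \<noteq> B" for A B
      using prime_dvd_binomial_primepow[OF \<open>prime r\<close> inter[OF that]] by (simp add: M_def s_def)
    show "of_int (M A B) = (\<Sum>J\<in>?G. of_bool (J \<subseteq> A) * U J B)" if "A \<in> F" "B \<in> F" for A B
    proof -
      let ?Js = "{J. J \<subseteq> A \<and> card J = s}"
      have "(\<Sum>J\<in>?G. of_bool (J \<subseteq> A) * U J B) = (\<Sum>J\<in>?Js. U J B)"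
        using F[OF that(1)] assms(1) by (intro sum.mono_neutral_cong_right) auto
      also have "\<dots> = (\<Sum>i\<le>s. coef i / of_nat ((k - i) choose (s - i)) *
          of_nat (\<Sum>J\<in>?Js. card (J \<inter> B) choose i))"
        unfolding U_def by (subst sum.swap) (simp add: sum_distrib_left)
      also have "\<dots> = (\<Sum>i\<le>s. of_nat (card (A \<inter> B) choose i) * coef i)"
      proof (rule sum.cong[OF refl])
        fix i assume "i \<in> {..s}"
        hence "i \<le> s" by simp
        \<comment> \<open>This is where \<open>r ^ e \<le> Suc k\<close> enters, in the form
          \<open>s \<le> k\<close>.\<close>
        have "(k - i) choose (s - i) \<noteq> 0" using \<open>s \<le> k\<close> by (simp add: binomial_eq_0_iff)
        thus "coef i / of_nat ((k - i) choose (s - i)) * of_nat (\<Sum>J\<in>?Js. card (J \<inter> B) choose i) =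
            of_nat (card (A \<inter> B) choose i) * coef i"
          using F[OF that(1)]
          unfolding sum_binomial_inter_subsets[OF finA[OF that(1)] \<open>i \<le> s\<close>] by simp
      qed
      also have "\<dots> = of_nat ((k - card (A \<inter> B) + s) choose s)"
        unfolding coef_def using F[OF that(1)] finA[OF that(1)]
        by (intro binomial_eq_sum_gchoose[symmetric]) (metis Int_lower1 card_mono)
      finally show ?thesis by (simp add: M_def)
    qed
  qed
  thus ?thesis using assms(1) by (simp add: n_subsets s_def)
qed

section \<open>Finiteness of the Borsuk number\<close>

lemma abs_index_le_lp_norm:
  assumes "p \<ge> 1" "i < dim_vec x"
  shows "\<bar>x $ i\<bar> \<le> lp_norm p x"
proof -
  have "\<bar>x $ i\<bar> = (\<bar>x $ i\<bar> powr p) powr (1 / p)" using assms by (simp add: powr_powr)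
  also have "\<dots> \<le> (\<Sum>i<dim_vec x. \<bar>x $ i\<bar> powr p) powr (1 / p)"
    using assms by (intro powr_mono2 member_le_sum) auto
  finally show ?thesis by (simp add: lp_norm_def)
qed

text \<open>The cruder factor \<open>d\<close> in place of \<open>d powr (1 / p)\<close> is still
  below the \<open>d + 1\<close> grid cells per diameter used later. The case \<open>d = 0\<close>
  is separate because \<open>d powr (1 / p) \<le> d powr 1\<close> is obtained from
  \<open>d \<ge> 1\<close>.\<close>

lemma lp_norm_le:
  fixes x :: "real vec"
  assumes "p \<ge> 1" "dim_vec x = d" "r \<ge> 0" "\<And>i. i < d \<Longrightarrow> \<bar>x $ i\<bar> \<le> r"
  shows "lp_norm p x \<le> real d * r"
proof (cases "d = 0")
  case True
  thus ?thesis using assms by (simp add: lp_norm_def)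
next
  case False
  have "(\<Sum>i<d. \<bar>x $ i\<bar> powr p) \<le> (\<Sum>i<d. r powr p)"
    using assms by (intro sum_mono powr_mono2) auto
  hence "lp_norm p x \<le> (real d * r powr p) powr (1 / p)"
    using assms unfolding lp_norm_def by (intro powr_mono2) (auto intro: sum_nonneg)
  also have "\<dots> = real d powr (1 / p) * r"
    using assms by (simp add: powr_mult powr_powr)
  also have "\<dots> \<le> real d powr 1 * r"
    using assms False by (intro mult_right_mono powr_mono) auto
  finally show ?thesis using False by simp
qed

lemma norm_diameter_leI:
  assumes "S \<noteq> {}" "\<And>x y. x \<in> S \<Longrightarrow> y \<in> S \<Longrightarrow> N (x - y) \<le> D"
  shows "norm_diameter N S \<le> D"
  unfolding norm_diameter_def using assms by (intro cSUP_least) auto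

lemma norm_diameter_upper:
  assumes "\<And>x y. x \<in> S \<Longrightarrow> y \<in> S \<Longrightarrow> N (x - y) \<le> B" "x \<in> S" "y \<in> S"
  shows "N (x - y) \<le> norm_diameter N S"
proof -
  have "bdd_above ((\<lambda>(x, y). N (x - y)) ` (S \<times> S))"
    using assms(1) by (intro bdd_aboveI[of _ B]) auto
  from cSUP_upper[OF _ this, of "(x, y)"] show ?thesis
    using assms by (simp add: norm_diameter_def)
qed

text \<open>Cut space into cubes of side \<open>D / (d + 1)\<close>, where \<open>D\<close> is the
  diameter of \<open>S\<close>. A cell has diameter at most \<open>d * D / (d + 1) < D\<close>.
  Coordinates relative to a point \<open>x0\<close> of \<open>S\<close> are at most \<open>D\<close>
  in absolute value, so after scaling their floors take at most \<open>2 * d + 3\<close>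
  values.\<close>

lemma borsuk_partitionable_lp:
  assumes "p \<ge> 1" and S: "S \<subseteq> carrier_vec d" and "norm_bounded (lp_norm p) S" and "\<not> is_singleton S"
  shows "borsuk_partitionable (lp_norm p) ((2 * d + 3) ^ d) S"
proof (cases "S = {}")
  case True
  thus ?thesis by (auto simp: borsuk_partitionable_def partition_on_def intro!: exI[of _ "{}"])
next
  case False
  then obtain x0 where x0: "x0 \<in> S" by blast
  then obtain x1 where x1: "x1 \<in> S" "x1 \<noteq> x0" using assms(4) by (auto simp: is_singleton_def)
  obtain B where B: "\<And>x. x \<in> S \<Longrightarrow> lp_norm p x \<le> B"
    using assms(3) by (auto simp: norm_bounded_def)
  have dim: "dim_vec x = d" if "x \<in> S" for x using S that by auto
  have "B \<ge> 0" using B[OF x0] by (rule order_trans[rotated]) (simp add: lp_norm_def)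
  have bound: "lp_norm p (x - y) \<le> real d * (2 * B)" if "x \<in> S" "y \<in> S" for x y
  proof (rule lp_norm_le)
    fix i assume "i < d"
    moreover have "\<bar>x $ i\<bar> \<le> B" "\<bar>y $ i\<bar> \<le> B"
      using abs_index_le_lp_norm[OF assms(1), of i x] abs_index_le_lp_norm[OF assms(1), of i y]
        B that dim \<open>i < d\<close> by fastforce+
    ultimately show "\<bar>(x - y) $ i\<bar> \<le> 2 * B" using dim[OF that(2)] by simp
  qed (use assms dim that \<open>B \<ge> 0\<close> in auto)
  define D where "D = norm_diameter (lp_norm p) S"
  have coord: "\<bar>x $ i - y $ i\<bar> \<le> D" if "x \<in> S" "y \<in> S" "i < d" for x y i
    using abs_index_le_lp_norm[OF assms(1), of i "x - y"] norm_diameter_upper[where N = "lp_norm p", OF bound that(1,2)]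
      that dim by (simp add: D_def)
  \<comment> \<open>Two distinct points differ in some coordinate, so the diameter is
    positive.\<close>
  obtain i0 where "i0 < d" "x1 $ i0 \<noteq> x0 $ i0"
    using x0 x1 dim by (metis eq_vecI)
  hence "D > 0" using coord[OF x1(1) x0, of i0] by auto
  define M where "M = real d + 1"
  define cell where "cell x = (\<lambda>i\<in>{..<d}. \<lfloor>(x $ i - x0 $ i) * M / D\<rfloor>)" for x
  let ?C = "{..<d} \<rightarrow>\<^sub>E {- int (d + 1)..int (d + 1)}"
  have cellC: "cell ` S \<subseteq> ?C"
  proof (rule image_subsetI)
    fix x assume "x \<in> S"
    show "cell x \<in> ?C"
    proof (rule PiE_I)
      fix i assume "i \<in> {..<d}"
      hence i: "i < d" by simp
      have "\<bar>(x $ i - x0 $ i) * M / D\<bar> = \<bar>x $ i - x0 $ i\<bar> / D * M"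
        using \<open>D > 0\<close> by (simp add: abs_mult M_def)
      also have "\<dots> \<le> 1 * M"
        using coord[OF \<open>x \<in> S\<close> x0 i] \<open>D > 0\<close> by (intro mult_right_mono) (auto simp: M_def)
      finally have "\<bar>(x $ i - x0 $ i) * M / D\<bar> \<le> real (d + 1)" by (simp add: M_def)
      hence "- real (d + 1) \<le> (x $ i - x0 $ i) * M / D" "(x $ i - x0 $ i) * M / D \<le> real (d + 1)"
        by (rule abs_le_D2[THEN le_imp_neg_le, unfolded minus_minus], rule abs_le_D1)
      hence "- int (d + 1) \<le> \<lfloor>(x $ i - x0 $ i) * M / D\<rfloor>" "\<lfloor>(x $ i - x0 $ i) * M / D\<rfloor> \<le> int (d + 1)"
        by linarith+
      thus "cell x i \<in> {- int (d + 1)..int (d + 1)}" using i by (simp add: cell_def)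
    qed (simp add: cell_def)
  qed
  have finC: "finite ?C" by (intro finite_PiE) auto
  have "nat (3 + 2 * int d) = 2 * d + 3" by simp
  hence cardC: "card ?C = (2 * d + 3) ^ d" by (simp add: card_PiE)
  let ?P = "(\<lambda>c. {x\<in>S. cell x = c}) ` (cell ` S)"
  have finS: "finite (cell ` S)" using cellC finC finite_subset by blast
  have "partition_on S ?P"
  proof (rule partition_onI)
    show "\<Union> ?P = S" by blast
    show "{} \<notin> ?P" by blast
    fix X Y assume "X \<in> ?P" "Y \<in> ?P" "X \<noteq> Y"
    moreover from this obtain c c' where "X = {x\<in>S. cell x = c}" "Y = {x\<in>S. cell x = c'}" by blast
    ultimately show "disjnt X Y" by (auto simp: disjnt_iff)
  qed
  moreover have "finite ?P" using finS by simp
  moreover have "card ?P \<le> (2 * d + 3) ^ d"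
    using card_image_le[OF finS, of "\<lambda>c. {x\<in>S. cell x = c}"] card_mono[OF finC cellC] cardC by simp
  moreover have "norm_diameter (lp_norm p) A < D" if AP: "A \<in> ?P" for A
  proof -
    obtain c where A: "A = {x\<in>S. cell x = c}" and c: "c \<in> cell ` S" using AP by (rule imageE)
    have ne: "A \<noteq> {}" using c unfolding A by blast
    have "norm_diameter (lp_norm p) A \<le> real d * (D / M)"
    proof (rule norm_diameter_leI[OF ne])
      fix x y assume xy: "x \<in> A" "y \<in> A"
      show "lp_norm p (x - y) \<le> real d * (D / M)"
      proof (rule lp_norm_le)
        fix i assume i: "i < d"
        have "cell x i = cell y i" using xy A by simp
        hence "\<lfloor>(x $ i - x0 $ i) * M / D\<rfloor> = \<lfloor>(y $ i - x0 $ i) * M / D\<rfloor>"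
          using i by (simp add: cell_def)
        hence "\<bar>(x $ i - x0 $ i) * M / D - (y $ i - x0 $ i) * M / D\<bar> \<le> 1" by linarith
        also have "(x $ i - x0 $ i) * M / D - (y $ i - x0 $ i) * M / D = (x $ i - y $ i) * M / D"
          by (simp add: algebra_simps flip: diff_divide_distrib)
        finally have "\<bar>x $ i - y $ i\<bar> * M / D \<le> 1"
          using \<open>D > 0\<close> by (simp add: abs_mult M_def)
        hence "\<bar>x $ i - y $ i\<bar> \<le> D / M"
          using \<open>D > 0\<close> by (simp add: field_simps M_def)
        thus "\<bar>(x - y) $ i\<bar> \<le> D / M" using i xy A dim by simp
      qed (use assms(1) xy A dim \<open>D > 0\<close> in \<open>auto simp: M_def\<close>)
    qed
    also have "\<dots> < D" using \<open>D > 0\<close> by (simp add: M_def field_simps)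
    finally show ?thesis .
  qed
  ultimately show ?thesis
    unfolding borsuk_partitionable_def D_def by (intro exI[of _ ?P] conjI ballI)
qed

text \<open>A \<open>LEAST\<close> is known to satisfy its predicate once some number does; the grid
  bound, uniform in \<open>S\<close>, is such a number.\<close>

lemma borsuk_partitionable_borsuk_number_lp:
  assumes "p \<ge> 1" "S \<subseteq> carrier_vec d" "norm_bounded (lp_norm p) S" "\<not> is_singleton S"
  shows "borsuk_partitionable (lp_norm p) (borsuk_number (carrier_vec d) (lp_norm p)) S"
proof -
  have "\<forall>S\<subseteq>carrier_vec d. norm_bounded (lp_norm p) S \<and> \<not> is_singleton S \<longrightarrow>
      borsuk_partitionable (lp_norm p) (borsuk_number (carrier_vec d) (lp_norm p)) S"
    unfolding borsuk_number_def
    by (rule LeastI[where k = "(2 * d + 3) ^ d"]) (use assms(1) borsuk_partitionable_lp in blast)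
  thus ?thesis using assms by blast
qed

section \<open>The point set\<close>

definition pairs :: "nat \<Rightarrow> (nat \<times> nat) set" where
  "pairs n = {(i, j). i < j \<and> j < n}"

lemma finite_pairs: "finite (pairs n)"
  by (rule finite_subset[of _ "{..<n} \<times> {..<n}"]) (auto simp: pairs_def)

text \<open>The square consists of \<open>pairs n\<close>, its mirror image and the diagonal.
  Products of one-variable functions have sums that factor over the square, but not over
  \<open>pairs n\<close>.\<close>

lemma sum_square_eq_pairs:
  fixes g :: "nat \<Rightarrow> nat \<Rightarrow> real"
  assumes sym: "\<And>i j. g i j = g j i"
  shows "(\<Sum>i<n. \<Sum>j<n. g i j) = 2 * (\<Sum>(i, j)\<in>pairs n. g i j) + (\<Sum>i<n. g i i)"
proof -
  let ?g = "\<lambda>(i, j). g i j"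
  have "(\<Sum>i<n. \<Sum>j<n. g i j) = sum ?g ({..<n} \<times> {..<n})" by (simp add: sum.cartesian_product)
  also have "{..<n} \<times> {..<n} = pairs n \<union> prod.swap ` pairs n \<union> (\<lambda>i. (i, i)) ` {..<n}"
    by (auto simp: pairs_def image_iff)
  also have "sum ?g \<dots> = sum ?g (pairs n) + sum ?g (prod.swap ` pairs n) + sum ?g ((\<lambda>i. (i, i)) ` {..<n})"
    by (subst sum.union_disjoint, use finite_pairs in \<open>auto simp: pairs_def\<close>)+
  also have "sum ?g (prod.swap ` pairs n) = sum ?g (pairs n)"
    by (subst sum.reindex) (auto simp: sym intro!: sum.cong)
  also have "sum ?g ((\<lambda>i. (i, i)) ` {..<n}) = (\<Sum>i<n. g i i)"
    by (subst sum.reindex) (auto simp: inj_on_def)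
  finally show ?thesis by simp
qed

lemma card_pairs: "card (pairs n) = n choose 2"
proof -
  have "real n * real n = 2 * real (card (pairs n)) + real n"
    using sum_square_eq_pairs[of "\<lambda>_ _. 1" n] by (simp add: case_prod_unfold)
  hence "real (n * n) = real (2 * card (pairs n) + n)" by simp
  hence "n * n = 2 * card (pairs n) + n" by (simp only: of_nat_eq_iff)
  hence "n * (n - 1) = 2 * card (pairs n)" by (simp add: diff_mult_distrib2)
  thus ?thesis by (simp add: choose_two)
qed

text \<open>The value is \<open>0\<close>, \<open>lam\<close> or \<open>1 + 2 * lam\<close> as none,
  one or both of two distinct points lie in \<open>A\<close>.\<close>

definition pair_val :: "real \<Rightarrow> nat set \<Rightarrow> nat \<times> nat \<Rightarrow> real" where
  "pair_val lam A = (\<lambda>(i, j).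
     lam * (of_bool (i \<in> A) + of_bool (j \<in> A)) + of_bool (i \<in> A) * of_bool (j \<in> A))"

text \<open>With \<open>u = k - t\<close>, this collects \<open>2 * u * t\<close> pairs with
  difference \<open>\<bar>1 + lam\<bar>\<close>, \<open>u * (u - 1)\<close> pairs with
  \<open>\<bar>1 + 2 * lam\<bar>\<close> and \<open>2 * u * (n - 2 * k + t)\<close> pairs with
  \<open>\<bar>lam\<bar>\<close>. The argument \<open>t\<close> is real so that the formula can be
  treated as a quadratic polynomial.\<close>

definition dist_sum :: "nat \<Rightarrow> nat \<Rightarrow> real \<Rightarrow> real \<Rightarrow> real \<Rightarrow> real" where
  "dist_sum n k p lam t = (real k - t) *
     (t * (2 * \<bar>lam\<bar> powr p + 2 * \<bar>1 + lam\<bar> powr p - \<bar>1 + 2 * lam\<bar> powr p)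
       + (real k - 1) * \<bar>1 + 2 * lam\<bar> powr p + 2 * (real n - 2 * real k) * \<bar>lam\<bar> powr p)"

text \<open>The contribution of a pair depends only on which of the classes
  \<open>A \<inter> B\<close>, \<open>A - B\<close>, \<open>B - A\<close> and the rest contain its
  two points. With the class indicators \<open>X\<close>, \<open>Y\<close>, \<open>Z\<close>,
  \<open>R\<close> it becomes a sum of products, which is summed over the square.\<close>

lemma sum_pair_val_diff:
  assumes AB: "A \<subseteq> {..<n}" "B \<subseteq> {..<n}" "card A = k" "card B = k" and "p \<ge> 1"
  shows "(\<Sum>e\<in>pairs n. \<bar>pair_val lam A e - pair_val lam B e\<bar> powr p) =
    dist_sum n k p lam (card (A \<inter> B))"
proof -
  define a b c where "a = \<bar>1 + lam\<bar> powr p" and "b = \<bar>lam\<bar> powr p" and "c = \<bar>1 + 2 * lam\<bar> powr p"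
  define t where "t = real (card (A \<inter> B))"
  define u where "u = real k - t"
  define X Y Z R :: "nat \<Rightarrow> real"
    where "X i = of_bool (i \<in> A \<and> i \<in> B)"
      and "Y i = of_bool (i \<in> A \<and> i \<notin> B)"
      and "Z i = of_bool (i \<in> B \<and> i \<notin> A)"
      and "R i = of_bool (i \<notin> A \<and> i \<notin> B)" for i
  have fin: "finite A" "finite B" using AB finite_subset by blast+
  have sumA: "(\<Sum>i<n. of_bool (i \<in> A)) = real k"
    using AB by (simp add: of_bool_def sum.If_cases Int_absorb1)
  have sumB: "(\<Sum>i<n. of_bool (i \<in> B)) = real k"
    using AB by (simp add: of_bool_def sum.If_cases Int_absorb1)
  have sX: "(\<Sum>i<n. X i) = t"
  proof -
    have "{..<n} \<inter> {i. i \<in> A \<and> i \<in> B} = A \<inter> B" using AB by auto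
    thus ?thesis by (simp add: X_def t_def of_bool_def sum.If_cases)
  qed
  have "(\<Sum>i<n. X i + Y i) = real k"
    unfolding sumA[symmetric] by (rule sum.cong) (auto simp: X_def Y_def)
  hence sY: "(\<Sum>i<n. Y i) = u" using sX by (simp add: sum.distrib u_def)
  have "(\<Sum>i<n. X i + Z i) = real k"
    unfolding sumB[symmetric] by (rule sum.cong) (auto simp: X_def Z_def)
  hence sZ: "(\<Sum>i<n. Z i) = u" using sX by (simp add: sum.distrib u_def)
  have "(\<Sum>i<n. X i + Y i + Z i + R i) = (\<Sum>i<n. 1)"
    by (rule sum.cong) (auto simp: X_def Y_def Z_def R_def)
  hence sR: "(\<Sum>i<n. R i) = real n - 2 * real k + t" using sX sY sZ by (simp add: sum.distrib u_def)
  define g where "g i j = \<bar>pair_val lam A (i, j) - pair_val lam B (i, j)\<bar> powr p" for i j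
  have g: "g i j = a * (X i * (Y j + Z j)) + a * ((Y i + Z i) * X j) + c * (Y i * Y j) + c * (Z i * Z j)
      + b * ((Y i + Z i) * R j) + b * (R i * (Y j + Z j))" for i j
    using \<open>p \<ge> 1\<close> abs_minus[of "1 + lam"] abs_minus[of "1 + 2 * lam"]
    by (cases "i \<in> A"; cases "i \<in> B"; cases "j \<in> A"; cases "j \<in> B")
       (simp_all add: g_def pair_val_def X_def Y_def Z_def R_def a_def b_def c_def algebra_simps)
  have full: "(\<Sum>i<n. \<Sum>j<n. g i j) = a * (t * (u + u))
      + a * ((u + u) * t)
      + c * (u * u) + c * (u * u)
      + b * ((u + u) * (real n - 2 * real k + t))
      + b * ((real n - 2 * real k + t) * (u + u))"
    by (simp only: g sum.distrib sX sY sZ sR sum_distrib_left[symmetric] sum_distrib_right[symmetric])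
  \<comment> \<open>On the diagonal \<open>pair_val\<close> is \<open>1 + 2 * lam\<close> inside the
    set and \<open>0\<close> outside, so the symmetric difference of \<open>A\<close> and
    \<open>B\<close> contributes.\<close>
  have "(\<Sum>i<n. g i i) = (\<Sum>i<n. c * (Y i + Z i))"
    by (rule sum.cong) (auto simp: g X_def Y_def Z_def R_def)
  also have "\<dots> = c * (u + u)"
    by (simp only: sum.distrib sY sZ sum_distrib_left[symmetric])
  finally have diag: "(\<Sum>i<n. g i i) = c * (u + u)" .
  have "(\<Sum>i<n. \<Sum>j<n. g i j) = 2 * (\<Sum>(i, j)\<in>pairs n. g i j) + (\<Sum>i<n. g i i)"
    by (rule sum_square_eq_pairs) (simp add: g_def pair_val_def add.commute mult.commute)
  moreover have "(\<Sum>i<n. \<Sum>j<n. g i j) - (\<Sum>i<n. g i i) =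
      2 * (u * (t * (2 * b + 2 * a - c) + (real k - 1) * c + 2 * (real n - 2 * real k) * b))"
  proof -
    \<comment> \<open>With \<open>K\<close> and \<open>N\<close> free, \<open>K\<close> can be
      replaced by \<open>u + t\<close>, which leaves a plain polynomial identity.\<close>
    have "a * (t * (u + u)) + a * ((u + u) * t) + c * (u * u) + c * (u * u)
        + b * ((u + u) * (N - 2 * K + t)) + b * ((N - 2 * K + t) * (u + u)) - c * (u + u) =
      2 * (u * (t * (2 * b + 2 * a - c) + (K - 1) * c + 2 * (N - 2 * K) * b))"
      if "u = K - t" for K N
    proof -
      from that have K: "K = u + t" by simp
      show ?thesis unfolding K by (simp add: algebra_simps)
    qed
    from this[OF u_def] show ?thesis unfolding full diag .
  qed
  ultimately have val: "(\<Sum>(i, j)\<in>pairs n. g i j) =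
      u * (t * (2 * b + 2 * a - c) + (real k - 1) * c + 2 * (real n - 2 * real k) * b)"
    by simp
  have "(\<Sum>e\<in>pairs n. \<bar>pair_val lam A e - pair_val lam B e\<bar> powr p) =
      (\<Sum>(i, j)\<in>pairs n. g i j)"
    by (rule sum.cong) (auto simp: g_def)
  thus ?thesis unfolding val dist_sum_def u_def a_def b_def c_def t_def .
qed

section \<open>The maximum of the distance polynomial\<close>

text \<open>The zero of the derivative of \<open>dist_sum n k p lam\<close>. It is a function of
  \<open>lam\<close> because \<open>lam\<close> will be moved.\<close>

definition dist_vertex :: "nat \<Rightarrow> nat \<Rightarrow> real \<Rightarrow> real \<Rightarrow> real" where
  "dist_vertex n k p lam = ((3 * real k - real n) * \<bar>lam\<bar> powr p + real k * \<bar>1 + lam\<bar> powr p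
                 + (1 / 2 - real k) * \<bar>1 + 2 * lam\<bar> powr p)
              / (2 * \<bar>lam\<bar> powr p + 2 * \<bar>1 + lam\<bar> powr p - \<bar>1 + 2 * lam\<bar> powr p)"

text \<open>On this range \<open>0 \<le> 1 + 2 * lam \<le> 1 + lam\<close>, so one of the two copies
  of \<open>\<bar>1 + lam\<bar> powr p\<close> absorbs the negative term. Positivity makes
  \<open>dist_sum\<close> strictly concave in \<open>t\<close>.\<close>

lemma dist_vertex_denom_pos:
  fixes p lam :: real
  assumes "p \<ge> 1" "- 1 / 2 \<le> lam" "lam \<le> 0"
  shows "2 * \<bar>lam\<bar> powr p + 2 * \<bar>1 + lam\<bar> powr p - \<bar>1 + 2 * lam\<bar> powr p > 0"
proof -
  have "\<bar>1 + 2 * lam\<bar> powr p \<le> \<bar>1 + lam\<bar> powr p" using assms by (intro powr_mono2) auto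
  moreover have "\<bar>1 + lam\<bar> powr p > 0" using assms by simp
  moreover have "\<bar>lam\<bar> powr p \<ge> 0" by simp
  ultimately show ?thesis by linarith
qed

text \<open>Completing the square, \<open>dist_sum\<close> decreases with the distance from the
  vertex, and no integer is closer to the vertex than one within \<open>1 / 2\<close> of it.\<close>

lemma dist_sum_le:
  fixes t t1 :: int
  assumes "p \<ge> 1" "- 1 / 2 \<le> lam" "lam \<le> 0" "\<bar>dist_vertex n k p lam - t1\<bar> \<le> 1 / 2"
  shows "dist_sum n k p lam t \<le> dist_sum n k p lam t1"
proof -
  define Q where "Q = 2 * \<bar>lam\<bar> powr p + 2 * \<bar>1 + lam\<bar> powr p - \<bar>1 + 2 * lam\<bar> powr p"
  define v where "v = dist_vertex n k p lam"
  have "Q > 0" using dist_vertex_denom_pos[OF assms(1-3)] by (simp add: Q_def)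
  have vQ: "v * Q = (3 * real k - real n) * \<bar>lam\<bar> powr p + real k * \<bar>1 + lam\<bar> powr p
                 + (1 / 2 - real k) * \<bar>1 + 2 * lam\<bar> powr p"
    using \<open>Q > 0\<close> unfolding v_def dist_vertex_def Q_def[symmetric] by simp
  have *: "dist_sum n k p lam x = dist_sum n k p lam 0 + 2 * x * (v * Q) - x ^ 2 * Q" for x
    unfolding vQ by (simp add: dist_sum_def Q_def algebra_simps power2_eq_square)
  have "\<bar>v - t1\<bar> \<le> \<bar>v - t\<bar>"
    using assms(4) unfolding v_def[symmetric] by (cases "t = t1") linarith+
  hence "(v - t1) ^ 2 \<le> (v - t) ^ 2" by (rule abs_le_square_iff[THEN iffD1])
  hence "Q * (v - t1) ^ 2 \<le> Q * (v - t) ^ 2" using \<open>Q > 0\<close> by simp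
  thus ?thesis unfolding *[of t] *[of t1] by (simp add: algebra_simps power2_eq_square)
qed

section \<open>From partitions of the point set to families of subsets\<close>

text \<open>Parts are pulled back along \<open>v\<close> to families that cover all
  \<open>k\<close>-subsets, so the count is right whether or not \<open>v\<close> is injective. Each
  family obeys the Frankl--Wilson bound.\<close>

lemma borsuk_number_lp_ge:
  fixes n k t1 :: nat
  assumes "1 < k" "2 * k < n" "p \<ge> 1" "- 1 / 2 \<le> lam" "lam \<le> 0" "d = n choose 2"
    and vertex: "\<bar>dist_vertex n k p lam - t1\<bar> \<le> 1 / 2" and "primepow (k - t1)"
    and "0 < t1" "2 * t1 < k"
  shows "n choose k \<le> borsuk_number (carrier_vec d) (lp_norm p) * (n choose (k - t1 - 1))"
proof -
  define D where "D = dist_sum n k p lam t1 powr (1 / p)"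
  have le_D: "dist_sum n k p lam (real t) powr (1 / p) \<le> D" if "dist_sum n k p lam (real t) \<ge> 0" for t
    using dist_sum_le[OF assms(3-5), of n k "int t1" "int t"] vertex that \<open>p \<ge> 1\<close>
    unfolding D_def by (intro powr_mono2) auto
  have "D > 0"
  proof -
    have "(real k - t1) * (t1 * (2 * \<bar>lam\<bar> powr p + 2 * \<bar>1 + lam\<bar> powr p - \<bar>1 + 2 * lam\<bar> powr p)
       + (real k - 1) * \<bar>1 + 2 * lam\<bar> powr p + 2 * (real n - 2 * real k) * \<bar>lam\<bar> powr p) > 0"
      using dist_vertex_denom_pos[OF assms(3-5)] assms(1,2,9,10)
      by (intro mult_pos_pos add_pos_nonneg mult_nonneg_nonneg) auto
    hence "dist_sum n k p lam t1 > 0" unfolding dist_sum_def .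
    thus ?thesis by (simp add: D_def)
  qed
  obtain h where h: "bij_betw h {..<d} (pairs n)"
    using ex_bij_betw_nat_finite[OF finite_pairs, of n] card_pairs[of n] assms(6)
    by (auto simp: atLeast0LessThan)
  define v where "v A = vec d (\<lambda>i. pair_val lam A (h i))" for A
  let ?K = "{A. A \<subseteq> {..<n} \<and> card A = k}"
  have finK: "finite ?K" by simp
  have norm_v: "lp_norm p (v A - v B) = dist_sum n k p lam (card (A \<inter> B)) powr (1 / p)"
    and nonneg: "dist_sum n k p lam (card (A \<inter> B)) \<ge> 0"
    if "A \<in> ?K" "B \<in> ?K" for A B
  proof -
    have "(\<Sum>i<d. \<bar>(v A - v B) $ i\<bar> powr p) =
        (\<Sum>i<d. \<bar>pair_val lam A (h i) - pair_val lam B (h i)\<bar> powr p)"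
      by (rule sum.cong) (auto simp: v_def)
    also have "\<dots> = (\<Sum>e\<in>pairs n. \<bar>pair_val lam A e - pair_val lam B e\<bar> powr p)"
      by (rule sum.reindex_bij_betw[OF h])
    also have eq: "\<dots> = dist_sum n k p lam (card (A \<inter> B))"
      using that assms(3) by (intro sum_pair_val_diff) auto
    finally show "lp_norm p (v A - v B) = dist_sum n k p lam (card (A \<inter> B)) powr (1 / p)"
      by (simp add: lp_norm_def v_def)
    show "dist_sum n k p lam (card (A \<inter> B)) \<ge> 0"
      unfolding eq[symmetric] by (rule sum_nonneg) simp
  qed
  let ?S = "v ` ?K"
  have norm_le: "lp_norm p (x - y) \<le> D" if "x \<in> ?S" "y \<in> ?S" for x y
    using that norm_v nonneg le_D by auto
  \<comment> \<open>Two intervals of length \<open>k\<close> overlapping in \<open>t1\<close>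
    points; they fit below \<open>n\<close> because \<open>2 * k < n\<close>. Their images are at
    distance \<open>D > 0\<close>.\<close>
  obtain A0 B0 where AB0: "A0 \<in> ?K" "B0 \<in> ?K" "card (A0 \<inter> B0) = t1"
  proof
    show "{..<k} \<in> ?K" using assms(2) by auto
    show "{k - t1..<2 * k - t1} \<in> ?K" using assms(2,10) by auto
    have "{..<k} \<inter> {k - t1..<2 * k - t1} = {k - t1..<k}" using assms(10) by auto
    thus "card ({..<k} \<inter> {k - t1..<2 * k - t1}) = t1" using assms(10) by simp
  qed
  have "v A0 \<noteq> v B0"
  proof
    assume "v A0 = v B0"
    hence "lp_norm p (v A0 - v B0) = lp_norm p (0\<^sub>v d)" by (simp add: v_def)
    also have "\<dots> = 0" using assms(3) by (simp add: lp_norm_def)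
    finally show False using norm_v[OF AB0(1,2)] AB0(3) \<open>D > 0\<close> by (simp add: D_def)
  qed
  hence "\<not> is_singleton ?S"
    using imageI[OF AB0(1), of v] imageI[OF AB0(2), of v]
    unfolding is_singleton_def by (metis (no_types) singletonD)
  moreover have "norm_bounded (lp_norm p) ?S"
  proof -
    have "bdd_above (lp_norm p ` ?S)" using finK by simp
    thus ?thesis by (auto simp: norm_bounded_def bdd_above_def)
  qed
  moreover have "?S \<subseteq> carrier_vec d" by (auto simp: v_def)
  ultimately have "borsuk_partitionable (lp_norm p) (borsuk_number (carrier_vec d) (lp_norm p)) ?S"
    by (intro borsuk_partitionable_borsuk_number_lp[OF assms(3)])
  then obtain P where P: "partition_on ?S P" "finite P"
      "card P \<le> borsuk_number (carrier_vec d) (lp_norm p)"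
      and small: "\<And>X. X \<in> P \<Longrightarrow> norm_diameter (lp_norm p) X < norm_diameter (lp_norm p) ?S"
    unfolding borsuk_partitionable_def by auto
  obtain r e where re: "prime r" "k - t1 = r ^ e"
    using assms(8) by (auto simp: primepow_def)
  have part: "card {A\<in>?K. v A \<in> X} \<le> n choose (k - t1 - 1)" if "X \<in> P" for X
  proof -
    have XS: "X \<subseteq> ?S" using P(1) that by (auto simp: partition_on_def)
    have avoid: "card (A \<inter> B) \<noteq> t1" if "A \<in> ?K" "v A \<in> X" "B \<in> ?K" "v B \<in> X" for A B
    proof
      assume "card (A \<inter> B) = t1"
      hence "D = lp_norm p (v A - v B)" using norm_v that by (simp add: D_def)
      also have "\<dots> \<le> norm_diameter (lp_norm p) X"
        using that by (intro norm_diameter_upper[where B = D] norm_le subsetD[OF XS])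
      also have "\<dots> < norm_diameter (lp_norm p) ?S" by (rule small[OF \<open>X \<in> P\<close>])
      also have "\<dots> \<le> D" using norm_le AB0 by (intro norm_diameter_leI) auto
      finally show False by simp
    qed
    have "card {A\<in>?K. v A \<in> X} \<le> card {..<n} choose (r ^ e - 1)"
    proof (rule frankl_wilson[where k = k])
      fix A B assume AB: "A \<in> {A\<in>?K. v A \<in> X}" "B \<in> {A\<in>?K. v A \<in> X}" "A \<noteq> B"
      have fin: "finite A" "finite B" using AB finite_subset by blast+
      have "card (A \<inter> B) < k"
      proof (rule ccontr)
        assume "\<not> card (A \<inter> B) < k"
        hence "A \<inter> B = A" "A \<inter> B = B"
          using AB fin by (intro card_seteq; simp)+
        thus False using AB by blast
      qed
      moreover have "card (A \<inter> B) \<noteq> t1" using avoid AB by blast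
      \<comment> \<open>The middle bound is \<open>k < 2 * (k - t1)\<close>, that is
        \<open>2 * t1 < k\<close>. The only multiple of \<open>k - t1\<close> strictly between
        \<open>0\<close> and \<open>2 * (k - t1)\<close> is \<open>k - t1\<close> itself, which
        would mean intersection size \<open>t1\<close>.\<close>
      ultimately have *: "0 < k - card (A \<inter> B)" "k - card (A \<inter> B) < 2 * (k - t1)"
        "k - card (A \<inter> B) \<noteq> k - t1" using assms(10) by auto
      show "\<not> r ^ e dvd k - card (A \<inter> B)"
      proof
        assume "r ^ e dvd k - card (A \<inter> B)"
        then obtain c where c: "k - card (A \<inter> B) = (k - t1) * c" using re by (auto elim: dvdE)
        hence "c < 2" "c \<noteq> 0" "c \<noteq> 1" using * by auto
        thus False by simp
      qed
    qed (use re in auto)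
    thus ?thesis using re by simp
  qed
  have K: "?K = (\<Union>X\<in>P. {A\<in>?K. v A \<in> X})"
    using P(1) unfolding partition_on_def by blast
  have "n choose k = card ?K" by (subst n_subsets) auto
  also have "\<dots> = card (\<Union>X\<in>P. {A\<in>?K. v A \<in> X})" by (rule arg_cong[OF K])
  also have "\<dots> \<le> (\<Sum>X\<in>P. card {A\<in>?K. v A \<in> X})" by (rule card_UN_le[OF P(2)])
  also have "\<dots> \<le> card P * (n choose (k - t1 - 1))"
    using sum_bounded_above[of P, OF part] by simp
  also have "\<dots> \<le> borsuk_number (carrier_vec d) (lp_norm p) * (n choose (k - t1 - 1))"
    using P(3) by simp
  finally show ?thesis .
qed

section \<open>Moving the parameter and conclusion\<close>

text \<open>If the vertex is at most \<open>t1\<close>, rounding already places it within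
  \<open>1 / 2\<close>. Otherwise it exceeds \<open>t1\<close> at \<open>lam\<close> and is below it
  at \<open>0\<close>, and the intermediate value theorem makes it equal to \<open>t1\<close>. The
  norm does not involve \<open>lam\<close>, so the replacement is harmless.\<close>

lemma ex_lambda_dist_vertex_near:
  fixes t1 :: int
  assumes "p \<ge> 1" "- 1 / 2 \<le> lam" "lam \<le> 0" "0 < t1" "t1 \<le> \<lfloor>dist_vertex n k p lam + 1 / 2\<rfloor>"
  shows "\<exists>mu. - 1 / 2 \<le> mu \<and> mu \<le> 0 \<and> \<bar>dist_vertex n k p mu - t1\<bar> \<le> 1 / 2"
proof (cases "dist_vertex n k p lam \<le> t1")
  case True
  hence "\<bar>dist_vertex n k p lam - t1\<bar> \<le> 1 / 2" using assms(5) by linarith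
  thus ?thesis using assms by blast
next
  case False
  \<comment> \<open>At \<open>0\<close> the vertex is
    \<open>(k + 1 / 2 - k) / (2 - 1) = 1 / 2\<close>, while \<open>t1 \<ge> 1\<close>.\<close>
  have "dist_vertex n k p 0 \<le> t1" using assms(1,4) by (simp add: dist_vertex_def)
  moreover have "continuous_on {lam..0} (dist_vertex n k p)"
  proof -
    have "2 * \<bar>x\<bar> powr p + 2 * \<bar>1 + x\<bar> powr p - \<bar>1 + 2 * x\<bar> powr p \<noteq> 0" if "x \<in> {lam..0}" for x
      using dist_vertex_denom_pos[of p x] assms that by auto
    \<comment> \<open>The base may vanish, for instance \<open>\<bar>x\<bar>\<close> at
      \<open>0\<close>; continuity there rests on \<open>p > 0\<close>.\<close>
    moreover have "continuous_on {lam..0} (\<lambda>x. \<bar>u + w * x\<bar> powr p)" for u w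
      by (rule continuous_on_powr') (use assms(1) in \<open>auto intro!: continuous_intros\<close>)
    from this[of 0 1] this[of 1 1] this[of 1 2]
    have "continuous_on {lam..0} (\<lambda>x. \<bar>x\<bar> powr p)" "continuous_on {lam..0} (\<lambda>x. \<bar>1 + x\<bar> powr p)"
      "continuous_on {lam..0} (\<lambda>x. \<bar>1 + 2 * x\<bar> powr p)" by simp_all
    ultimately show ?thesis unfolding dist_vertex_def
      by (intro continuous_on_divide continuous_on_add continuous_on_diff continuous_on_mult
          continuous_on_const) auto
  qed
  ultimately obtain mu where "lam \<le> mu" "mu \<le> 0" "dist_vertex n k p mu = t1"
    using IVT2'[of "dist_vertex n k p" 0 "real_of_int t1" lam] False assms(3) by auto
  thus ?thesis using assms(2) by (intro exI[of _ mu]) auto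
qed

theorem theorem1:
  fixes n k d :: nat and p lam t0 :: real and t1 :: int
  assumes "1 < k" and "real k < real n / 2"
    and "p \<ge> 1"
    and "- 1 / 2 \<le> lam" and "lam \<le> 0"
    and "d = n choose 2"
    and "t0 = ((3 * real k - real n) * \<bar>lam\<bar> powr p + real k * \<bar>1 + lam\<bar> powr p
                 + (1 / 2 - real k) * \<bar>1 + 2 * lam\<bar> powr p)
              / (2 * \<bar>lam\<bar> powr p + 2 * \<bar>1 + lam\<bar> powr p - \<bar>1 + 2 * lam\<bar> powr p)"
    and "t1 \<le> \<lfloor>t0 + 1 / 2\<rfloor>" and "primepow (int k - t1)"
    and "\<And>t :: int. t \<le> \<lfloor>t0 + 1 / 2\<rfloor> \<Longrightarrow> primepow (int k - t) \<Longrightarrow> t \<le> t1"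
    and "0 < t1" and "real_of_int t1 < real k / 2"
  shows "real (borsuk_number (carrier_vec d) (lp_norm p))
           \<ge> real (n choose k) / real (n choose nat (int k - t1 - 1))"
proof -
  have "t1 \<le> \<lfloor>dist_vertex n k p lam + 1 / 2\<rfloor>"
    using assms(7,8) by (simp add: dist_vertex_def)
  then obtain mu where mu: "- 1 / 2 \<le> mu" "mu \<le> 0" "\<bar>dist_vertex n k p mu - t1\<bar> \<le> 1 / 2"
    using ex_lambda_dist_vertex_near[OF assms(3-5,11)] by blast
  define t where "t = nat t1"
  have t: "int t = t1" using assms(11) by (simp add: t_def)
  have tk: "2 * t < k" using assms(12) unfolding t[symmetric] by simp
  have kn: "2 * k < n" using assms(2) by linarith
  have kt: "nat (int k - t1 - 1) = k - t - 1" using t tk by simp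
  have "int k - t1 = int (k - t)" using t tk by simp
  \<comment> \<open>The prime power is given over the integers, while the counting needs it over the
    naturals.\<close>
  then obtain q e where q: "prime q" "e > 0" "int (k - t) = q ^ e"
    using assms(9) by (auto simp: primepow_def)
  hence "prime (nat q)" "k - t = nat q ^ e"
    by (auto simp: prime_ge_0_int simp flip: nat_power_eq)
  hence "primepow (k - t)" using q(2) unfolding primepow_def by blast
  hence "n choose k \<le> borsuk_number (carrier_vec d) (lp_norm p) * (n choose (k - t - 1))"
    using mu t tk kn assms(1,3,6,11) by (intro borsuk_number_lp_ge[where lam = mu]) auto
  hence "real (n choose k) \<le>
      real (borsuk_number (carrier_vec d) (lp_norm p)) * real (n choose (k - t - 1))"
    by (metis of_nat_le_iff of_nat_mult)
  moreover have "n choose (k - t - 1) > 0" using kn by (intro zero_less_binomial) simp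
  ultimately show ?thesis unfolding kt by (simp add: field_simps)
qed

end
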